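(* Let $\mathbf{E}$ be a Euclidean space and suppose closed sets $F_1, F_2, \ldots, F_m \subset \mathbf{E}$ have strongly regular intersection at a point $\bar x \in \bigcap_i F_i$. Define a constant $\bar c \in [0,1)$ by $$\bar c^2 = \begin{cases} 0 & \text{if } \bar x \in \bigcap_i \operatorname{int} F_i, \\ 1 - \dfrac{1}{m \cdot \operatorname{cond}^2(F_1,\ldots,F_m|\bar x)} & \text{otherwise,}\end{cases}$$ and fix any constant $c \in (\bar c, 1)$. Then: (i) for any initial point $x_0 \in \mathbf{E}$ sufficiently close to $\bar x$, any sequence $(x_n)$ generated by the method of averaged projections on $F_1,\ldots,F_m$ converges to a point in $\bigcap_i F_i$ with R-linear rate $c$; (ii) if moreover each set $F_i$ is super-regular at $\bar x$, then in (i) the convergence is with R-linear rate $c^2$; (iii) for any sufficiently small perturbations $d_i \in \mathbf{E}$ $(i=1,\ldots,m)$, any sequence generated by the method of averaged projections applied to the sets $d_i + F_i$, with initial point $\bar x$, converges with R-linear rate $c$ to a nearby point in the intersection $\bigcap_i (d_i + F_i)$ (that is, for every neighborhood $U$ of $\bar x$, the limit lies in $U$ provided all $d_i$ are small enough).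
   Context: For a set $F \subset \mathbf{E}$, $P_F(x) = \operatorname{argmin}\{\|z-x\| : z \in F\}$ is the (multivalued) projection. For a closed set $F$ and $\bar x \in F$, the normal cone is $N_F(\bar x) = \{ \lim_i t_i(x_i - z_i) : t_i \ge 0,\ x_i \to \bar x,\ z_i \in P_F(x_i)\}$. Closed sets $F_1,\ldots,F_m$ have strongly regular intersection at $\bar x \in \bigcap_i F_i$ if the only vectors $y_i \in N_{F_i}(\bar x)$ $(i=1,\ldots,m)$ with $\sum_i y_i = 0$ are $y_1=\cdots=y_m=0$. The condition modulus $\operatorname{cond}(F_1,\ldots,F_m|\bar x)$ is the infimum of all $k>0$ such that $\sqrt{\sum_i \|y_i\|^2} \le k\|\sum_i y_i\|$ whenever $y_i \in N_{F_i}(\bar x)$ for $i=1,\ldots,m$. The method of averaged projections on sets $F_1,\ldots,F_m$ from $x_0$ iterates: $z_n^i \in P_{F_i}(x_n)$ $(i=1,\ldots,m)$, $x_{n+1} = \frac1m(z_n^1+\cdots+z_n^m)$. A closed set $C$ is super-regular at $\bar x \in C$ if for every $\delta > 0$ there is a neighborhood of $\bar x$ such that for all points $u, z$ in that neighborhood with $z \in C$ and all $y \in P_C(u)$, $\langle z-y, u-y\rangle \le \delta \|z-y\|\cdot\|u-y\|$. A sequence $(x_n)$ converges to $\hat x$ with R-linear rate $r \in (0,1)$ if there is a constant $K$ with $\|x_n - \hat x\| \le K r^n$ for all $n$. *)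

theory Defs
  imports "HOL-Analysis.Analysis"
begin

text \<open>Families of sets are indexed by the natural numbers \<^term>\<open>{1..m}\<close>; values of the
  family outside that range are irrelevant.\<close>

definition metric_projection :: "'a::euclidean_space set \<Rightarrow> 'a \<Rightarrow> 'a set" where
  "metric_projection F x = {z \<in> F. \<forall>w\<in>F. norm (z - x) \<le> norm (w - x)}"

definition normal_cone :: "'a::euclidean_space set \<Rightarrow> 'a \<Rightarrow> 'a set" where
  "normal_cone F xbar =
    {v. \<exists>t x z. (\<forall>i::nat. t i \<ge> 0) \<and> x \<longlonglongrightarrow> xbar \<and>
          (\<forall>i. z i \<in> metric_projection F (x i)) \<and>
          (\<lambda>i. t i *\<^sub>R (x i - z i)) \<longlonglongrightarrow> v}"

definition strongly_regular_intersection ::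
    "nat \<Rightarrow> (nat \<Rightarrow> 'a::euclidean_space set) \<Rightarrow> 'a \<Rightarrow> bool" where
  "strongly_regular_intersection m F xbar \<longleftrightarrow>
    (\<forall>y. (\<forall>i\<in>{1..m}. y i \<in> normal_cone (F i) xbar) \<and> (\<Sum>i=1..m. y i) = 0 \<longrightarrow>
         (\<forall>i\<in>{1..m}. y i = 0))"

text \<open>The infimum is taken in the reals, so it is meaningful only if some admissible \<open>k\<close> exists.
  Strong regularity at a common point of closed sets guarantees this; without it the modulus
  would be infinite and the value below is unspecified.\<close>

definition cond_modulus ::
    "nat \<Rightarrow> (nat \<Rightarrow> 'a::euclidean_space set) \<Rightarrow> 'a \<Rightarrow> real" where
  "cond_modulus m F xbar =
    Inf {k. k > 0 \<and>
      (\<forall>y. (\<forall>i\<in>{1..m}. y i \<in> normal_cone (F i) xbar) \<longrightarrow>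
           sqrt (\<Sum>i=1..m. (norm (y i))\<^sup>2) \<le> k * norm (\<Sum>i=1..m. y i))}"

text \<open>The projections are multivalued, so a given family may generate many sequences from the same
  initial point \<^term>\<open>x 0\<close>.\<close>

definition averaged_projections ::
    "nat \<Rightarrow> (nat \<Rightarrow> 'a::euclidean_space set) \<Rightarrow> (nat \<Rightarrow> 'a) \<Rightarrow> bool" where
  "averaged_projections m F x \<longleftrightarrow>
    (\<exists>z. \<forall>n. (\<forall>i\<in>{1..m}. z n i \<in> metric_projection (F i) (x n)) \<and>
             x (Suc n) = (1 / real m) *\<^sub>R (\<Sum>i=1..m. z n i))"

definition super_regular :: "'a::euclidean_space set \<Rightarrow> 'a \<Rightarrow> bool" where
  "super_regular C xbar \<longleftrightarrow>
    (\<forall>\<delta>>0. \<exists>U. open U \<and> xbar \<in> U \<and>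
      (\<forall>u\<in>U. \<forall>z\<in>U \<inter> C. \<forall>y\<in>metric_projection C u.
         inner (z - y) (u - y) \<le> \<delta> * norm (z - y) * norm (u - y)))"

definition R_linear_convergence ::
    "(nat \<Rightarrow> 'a::euclidean_space) \<Rightarrow> 'a \<Rightarrow> real \<Rightarrow> bool" where
  "R_linear_convergence x xhat r \<longleftrightarrow>
    0 < r \<and> r < 1 \<and> (\<exists>K. \<forall>n. norm (x n - xhat) \<le> K * r ^ n)"

end

theory Submission
  imports Defs
begin

text \<open>With \<open>v\<^sub>i = x - z\<^sub>i\<close> for projections \<open>z\<^sub>i\<close> of \<open>x\<close>, the averaged point is \<open>x' = x - mean v\<close>, and
  Pythagoras gives \<open>\<Sum>\<parallel>x' - z\<^sub>i\<parallel>\<^sup>2 = \<Sum>\<parallel>v\<^sub>i\<parallel>\<^sup>2 - \<parallel>\<Sum>v\<^sub>i\<parallel>\<^sup>2 / m\<close>.  By compactness, every constant larger than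
  the condition modulus also works for the vectors \<open>v\<^sub>i\<close> at points near \<open>xbar\<close>, so that one step
  shrinks the distance to the product of the sets by the factor \<open>c\<close>; the steps are then dominated
  by a geometric series.  Under super-regularity the same estimate is gained a second time, by
  pairing the new residuals with the old ones, which are orthogonal to the diagonal.\<close>

section \<open>The product norm and averages\<close>

text \<open>This is the norm of the product of copies of the space indexed by \<open>I\<close>.
  Points of the product are plain functions, so values outside \<open>I\<close> do not matter and
  index sets can be varied freely.\<close>

definition l2_norm :: "'b set \<Rightarrow> ('b \<Rightarrow> 'a::euclidean_space) \<Rightarrow> real" where
  "l2_norm I f = L2_set (\<lambda>i. norm (f i)) I"

definition mean :: "'b set \<Rightarrow> ('b \<Rightarrow> 'a::euclidean_space) \<Rightarrow> 'a" where
  "mean I f = (1 / real (card I)) *\<^sub>R (\<Sum>i\<in>I. f i)"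

lemma l2_norm_nonneg [simp]: "0 \<le> l2_norm I f"
  by (simp add: l2_norm_def)

lemma l2_norm_power2: "(l2_norm I f)\<^sup>2 = (\<Sum>i\<in>I. (norm (f i))\<^sup>2)"
  by (simp add: l2_norm_def L2_set_def sum_nonneg)

lemma l2_norm_mono:
  assumes "\<And>i. i \<in> I \<Longrightarrow> norm (f i) \<le> norm (g i)"
  shows "l2_norm I f \<le> l2_norm I g"
  unfolding l2_norm_def by (rule L2_set_mono) (use assms in auto)

lemma l2_norm_cong:
  assumes "\<And>i. i \<in> I \<Longrightarrow> norm (f i) = norm (g i)"
  shows "l2_norm I f = l2_norm I g"
  using assms by (simp add: l2_norm_def L2_set_def)

lemma norm_le_l2_norm:
  assumes "finite I" "i \<in> I"
  shows "norm (f i) \<le> l2_norm I f"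
  unfolding l2_norm_def using assms by (rule member_le_L2_set)

lemma l2_norm_le_sum: "l2_norm I f \<le> (\<Sum>i\<in>I. norm (f i))"
  unfolding l2_norm_def by (rule L2_set_le_sum) auto

lemma l2_norm_le_bound:
  assumes "\<And>i. i \<in> I \<Longrightarrow> norm (f i) \<le> b"
  shows "l2_norm I f \<le> real (card I) * b"
proof -
  have "(\<Sum>i\<in>I. norm (f i)) \<le> real (card I) * b"
    using assms by (rule sum_bounded_above)
  then show ?thesis
    using l2_norm_le_sum[of I f] by linarith
qed

lemma l2_norm_triangle: "l2_norm I (\<lambda>i. f i + g i) \<le> l2_norm I f + l2_norm I g"
proof -
  have "l2_norm I (\<lambda>i. f i + g i) \<le> L2_set (\<lambda>i. norm (f i) + norm (g i)) I"
    unfolding l2_norm_def by (rule L2_set_mono) (simp_all add: norm_triangle_ineq)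
  also have "\<dots> \<le> l2_norm I f + l2_norm I g"
    unfolding l2_norm_def by (rule L2_set_triangle_ineq)
  finally show ?thesis .
qed

lemma sum_norm_mult_le: "(\<Sum>i\<in>I. norm (f i) * norm (g i)) \<le> l2_norm I f * l2_norm I g"
proof -
  have "(\<Sum>i\<in>I. \<bar>norm (f i)\<bar> * \<bar>norm (g i)\<bar>) \<le> l2_norm I f * l2_norm I g"
    unfolding l2_norm_def by (rule L2_set_mult_ineq)
  then show ?thesis
    by (simp only: abs_norm_cancel)
qed

lemma sum_inner_le: "(\<Sum>i\<in>I. inner (f i) (g i)) \<le> l2_norm I f * l2_norm I g"
proof -
  have "(\<Sum>i\<in>I. inner (f i) (g i)) \<le> (\<Sum>i\<in>I. norm (f i) * norm (g i))"
    by (intro sum_mono norm_cauchy_schwarz)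
  also have "\<dots> \<le> l2_norm I f * l2_norm I g"
    by (rule sum_norm_mult_le)
  finally show ?thesis .
qed

lemma l2_norm_scaleR: "l2_norm I (\<lambda>i. t *\<^sub>R f i) = \<bar>t\<bar> * l2_norm I f"
  by (simp add: l2_norm_def L2_set_def power_mult_distrib sum_distrib_left[symmetric] real_sqrt_mult)

lemma tendsto_l2_norm:
  assumes "\<And>i. i \<in> I \<Longrightarrow> (\<lambda>n. f n i) \<longlonglongrightarrow> g i"
  shows "(\<lambda>n. l2_norm I (f n)) \<longlonglongrightarrow> l2_norm I g"
  unfolding l2_norm_def L2_set_def by (intro tendsto_intros assms)

lemma sum_eq_card_mean:
  assumes "finite I" "I \<noteq> {}" shows "(\<Sum>i\<in>I. f i) = real (card I) *\<^sub>R mean I f"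
  using assms by (simp add: mean_def)

lemma mean_const_diff:
  assumes "finite I" "I \<noteq> {}"
  shows "mean I (\<lambda>i. x - f i) = x - mean I f"
  using assms by (simp add: mean_def sum_subtractf scaleR_diff_right sum_constant_scaleR)

text \<open>Pythagoras in the product space: the constant family with value \<open>mean I f\<close>
  is the orthogonal projection of \<open>f\<close> onto the diagonal, and its squared norm is
  \<open>real (card I)\<close> times that of the mean.\<close>

lemma l2_norm_deviation:
  assumes "finite I" "I \<noteq> {}"
  shows "(l2_norm I (\<lambda>i. f i - mean I f))\<^sup>2
    = (l2_norm I f)\<^sup>2 - real (card I) * (norm (mean I f))\<^sup>2"
proof -
  have "(l2_norm I (\<lambda>i. f i - mean I f))\<^sup>2
      = (\<Sum>i\<in>I. (norm (f i))\<^sup>2 - 2 * inner (f i) (mean I f) + (norm (mean I f))\<^sup>2)"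
    unfolding l2_norm_power2 power2_norm_eq_inner
    by (intro sum.cong refl) (simp add: inner_diff_left inner_diff_right inner_commute)
  also have "\<dots> = (l2_norm I f)\<^sup>2 - 2 * inner (\<Sum>i\<in>I. f i) (mean I f)
      + real (card I) * (norm (mean I f))\<^sup>2"
    by (simp add: sum.distrib sum_subtractf sum_distrib_left[symmetric] inner_sum_left l2_norm_power2)
  finally show ?thesis
    by (simp add: sum_eq_card_mean[OF assms] power2_norm_eq_inner)
qed

text \<open>The left side of the Pythagoras identity is nonnegative. Applied to residuals, this
  bounds the length of one step of the iteration by the product distance to the chosen
  projections.\<close>

lemma norm_mean_le:
  assumes "finite I" "I \<noteq> {}"
  shows "norm (mean I f) \<le> l2_norm I f"
proof -
  have c: "1 \<le> real (card I)"
    using assms by (simp add: Suc_leI card_gt_0_iff)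
  have "1 * (norm (mean I f))\<^sup>2 \<le> real (card I) * (norm (mean I f))\<^sup>2"
    by (rule mult_right_mono[OF c]) simp
  also have "\<dots> \<le> (l2_norm I f)\<^sup>2"
    using l2_norm_deviation[OF assms, of f] zero_le_power2[of "l2_norm I (\<lambda>i. f i - mean I f)"]
    by linarith
  finally show ?thesis
    using power2_le_imp_le by fastforce
qed

text \<open>A lower bound on the sum says that \<open>f\<close> has a large component along the
  diagonal, which Pythagoras turns into a small orthogonal component. The hypothesis is the squared
  regularity inequality with constant \<open>k\<close> such that
  \<open>k^2 = 1 / (card I * (1 - c^2))\<close>.\<close>

lemma l2_norm_deviation_le:
  assumes "finite I" "I \<noteq> {}"
    and "real (card I) * (1 - c\<^sup>2) * (l2_norm I f)\<^sup>2 \<le> (norm (\<Sum>i\<in>I. f i))\<^sup>2" "0 \<le> c"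
  shows "l2_norm I (\<lambda>i. f i - mean I f) \<le> c * l2_norm I f"
proof (rule power2_le_imp_le)
  have p: "0 < real (card I)"
    using assms by (simp add: card_gt_0_iff)
  have "real (card I) * ((1 - c\<^sup>2) * (l2_norm I f)\<^sup>2) \<le> real (card I) * (real (card I) * (norm (mean I f))\<^sup>2)"
    using assms(3) by (simp add: sum_eq_card_mean[OF assms(1,2)] power_mult_distrib power2_eq_square algebra_simps)
  then have "(1 - c\<^sup>2) * (l2_norm I f)\<^sup>2 \<le> real (card I) * (norm (mean I f))\<^sup>2"
    using p by simp
  then show "(l2_norm I (\<lambda>i. f i - mean I f))\<^sup>2 \<le> (c * l2_norm I f)\<^sup>2"
    by (simp add: l2_norm_deviation[OF assms(1,2)] algebra_simps power_mult_distrib)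
qed (use assms in simp)

section \<open>Projections and proximal normals\<close>

lemma metric_projection_le:
  assumes "z \<in> metric_projection F x" "w \<in> F"
  shows "norm (x - z) \<le> norm (x - w)"
  using assms by (auto simp: metric_projection_def norm_minus_commute)

lemma metric_projection_mem: "z \<in> metric_projection F x \<Longrightarrow> z \<in> F"
  by (simp add: metric_projection_def)

lemma metric_projection_nonempty:
  assumes "closed F" "F \<noteq> {}"
  shows "\<exists>z. z \<in> metric_projection F x"
proof -
  obtain z where "z \<in> F" "\<And>w. w \<in> F \<Longrightarrow> dist x z \<le> dist x w"
    using distance_attains_inf[OF assms] by blast
  then show ?thesis
    by (auto simp: metric_projection_def dist_norm norm_minus_commute)
qed

lemma metric_projection_self:
  assumes "z \<in> metric_projection F x" "x \<in> F"
  shows "z = x"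
  using metric_projection_le[OF assms] by simp

text \<open>Moving the set by \<open>d\<close> amounts to moving the point by \<open>-d\<close>, and
  the residual is the same vector. Perturbed sets are thereby reduced to the original ones at
  shifted points.\<close>

lemma metric_projection_translation:
  assumes "z \<in> metric_projection ((+) d ` F) x"
  shows "z - d \<in> metric_projection F (x - d)"
proof -
  obtain w where w: "w \<in> F" "z = d + w"
    using assms by (auto simp: metric_projection_def)
  have "norm (z - x) \<le> norm (d + v - x)" if "v \<in> F" for v
    using assms that by (auto simp: metric_projection_def)
  then show ?thesis
    using w by (simp add: metric_projection_def algebra_simps)
qed

section \<open>Proximal normals and their limits\<close>

definition proximal_normals :: "'a::euclidean_space set \<Rightarrow> 'a \<Rightarrow> real \<Rightarrow> 'a set" where
  "proximal_normals F a e =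
    {t *\<^sub>R (u - z) | t u z. 0 \<le> t \<and> dist u a < e \<and> z \<in> metric_projection F u}"

lemma proximal_normalsI:
  assumes "0 \<le> t" "dist u a < e" "z \<in> metric_projection F u"
  shows "t *\<^sub>R (u - z) \<in> proximal_normals F a e"
  using assms by (auto simp: proximal_normals_def)

lemma proximal_normals_diff:
  assumes "dist u a < e" "z \<in> metric_projection F u"
  shows "u - z \<in> proximal_normals F a e"
  using proximal_normalsI[OF zero_le_one assms] by simp

lemma proximal_normals_scaleR:
  assumes "v \<in> proximal_normals F a e" "0 \<le> s"
  shows "s *\<^sub>R v \<in> proximal_normals F a e"
proof -
  obtain t u z where "v = t *\<^sub>R (u - z)" "0 \<le> t" "dist u a < e" "z \<in> metric_projection F u"
    using assms(1) by (auto simp: proximal_normals_def)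
  then show ?thesis
    using proximal_normalsI[of "s * t" u a e z F] assms(2) by simp
qed

text \<open>The radii \<open>e n\<close> force the underlying points \<open>u n\<close> to tend to
  \<open>a\<close>, so the representations of the \<open>w n\<close> together form a witness for the
  normal cone. Together with \<open>normal_cone_approx\<close>, this exhibits the cone as the limit
  of the sets \<open>proximal_normals F a e\<close> for shrinking \<open>e\<close>.\<close>

lemma normal_cone_limit:
  assumes "\<And>n. w n \<in> proximal_normals F a (e n)" "e \<longlonglongrightarrow> 0" "w \<longlonglongrightarrow> v"
  shows "v \<in> normal_cone F a"
proof -
  have "\<exists>t u z. w n = t *\<^sub>R (u - z) \<and> 0 \<le> t \<and> dist u a < e n \<and> z \<in> metric_projection F u" for n
    using assms(1)[of n] by (auto simp: proximal_normals_def)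
  then obtain t u z where *: "\<And>n. w n = t n *\<^sub>R (u n - z n)" "\<And>n. 0 \<le> t n"
      "\<And>n. dist (u n) a < e n" "\<And>n. z n \<in> metric_projection F (u n)"
    by metis
  have "dist (u n) a \<le> dist (e n) 0" for n
    using *(3)[of n] by (simp add: dist_real_def)
  then have "u \<longlonglongrightarrow> a"
    by (intro metric_tendsto_imp_tendsto[OF assms(2)] always_eventually) simp
  moreover have "(\<lambda>n. t n *\<^sub>R (u n - z n)) \<longlonglongrightarrow> v"
    using assms(3) unfolding *(1)[symmetric] .
  ultimately show ?thesis
    using *(2,4) unfolding normal_cone_def by blast
qed

lemma normal_cone_approx:
  assumes "v \<in> normal_cone F a" "0 < e"
  shows "\<exists>w. (\<forall>n. w n \<in> proximal_normals F a e) \<and> w \<longlonglongrightarrow> v"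
proof -
  obtain t x z where *: "\<And>i::nat. t i \<ge> 0" "x \<longlonglongrightarrow> a"
      "\<And>i. z i \<in> metric_projection F (x i)" "(\<lambda>i. t i *\<^sub>R (x i - z i)) \<longlonglongrightarrow> v"
    using assms(1) by (auto simp: normal_cone_def)
  obtain N where N: "\<And>n. n \<ge> N \<Longrightarrow> dist (x n) a < e"
    using *(2) assms(2) by (meson LIMSEQ_def)
  have "t (n + N) *\<^sub>R (x (n + N) - z (n + N)) \<in> proximal_normals F a e" for n
    using N *(1,3) by (intro proximal_normalsI) auto
  moreover have "(\<lambda>n. t (n + N) *\<^sub>R (x (n + N) - z (n + N))) \<longlonglongrightarrow> v"
    using *(4) by (rule LIMSEQ_ignore_initial_segment)
  ultimately show ?thesis
    by (intro exI[of _ "\<lambda>n. t (n + N) *\<^sub>R (x (n + N) - z (n + N))"]) simp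
qed

lemma zero_in_normal_cone:
  assumes "a \<in> F"
  shows "0 \<in> normal_cone F a"
proof (rule normal_cone_limit)
  show "0 \<in> proximal_normals F a (1 / real (Suc n))" for n
    using proximal_normalsI[of 0 a a "1 / real (Suc n)" a F] assms by (simp add: metric_projection_def)
  show "(\<lambda>n. 1 / real (Suc n)) \<longlonglongrightarrow> 0"
    by (rule LIMSEQ_Suc[OF lim_1_over_n])
qed auto

text \<open>Arbitrarily close to a non-interior point there are points outside \<open>F\<close>,
  whose residuals are nonzero. Normalized residuals accumulate on the unit sphere, and any
  accumulation point is a normal.\<close>

lemma exists_unit_normal:
  assumes "closed F" "a \<in> F" "a \<notin> interior F"
  shows "\<exists>v \<in> normal_cone F a. norm v = 1"
proof -
  have "\<exists>w. norm w = 1 \<and> w \<in> proximal_normals F a (1 / real (Suc n))" for n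
  proof -
    have "\<not> ball a (1 / real (Suc n)) \<subseteq> F"
    proof
      assume "ball a (1 / real (Suc n)) \<subseteq> F"
      then have "a \<in> interior F"
        unfolding mem_interior by (intro exI[of _ "1 / real (Suc n)"]) auto
      then show False
        using assms(3) by simp
    qed
    then obtain u where "u \<in> ball a (1 / real (Suc n))" "u \<notin> F"
      by blast
    then have u: "dist u a < 1 / real (Suc n)" "u \<notin> F"
      by (simp_all add: dist_commute)
    obtain z where z: "z \<in> metric_projection F u"
      using metric_projection_nonempty assms(1,2) by blast
    then have "u - z \<noteq> 0"
      using u(2) metric_projection_mem by auto
    then show ?thesis
      using proximal_normalsI[OF _ u(1) z, of "inverse (norm (u - z))"]
      by (intro exI[of _ "inverse (norm (u - z)) *\<^sub>R (u - z)"]) auto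
  qed
  then obtain w where w: "\<And>n. norm (w n) = 1" "\<And>n. w n \<in> proximal_normals F a (1 / real (Suc n))"
    by metis
  have "compact (sphere (0::'a) 1)" "\<forall>n. w n \<in> sphere 0 1"
    using w(1) by auto
  then obtain v r where r: "v \<in> sphere 0 1" "strict_mono (r :: nat \<Rightarrow> nat)" "(w \<circ> r) \<longlonglongrightarrow> v"
    unfolding compact_def by blast
  have "(\<lambda>n. 1 / real (Suc n)) \<longlonglongrightarrow> 0"
    by (rule LIMSEQ_Suc[OF lim_1_over_n])
  then have "((\<lambda>n. 1 / real (Suc n)) \<circ> r) \<longlonglongrightarrow> 0"
    using r(2) by (rule LIMSEQ_subseq_LIMSEQ)
  then have "v \<in> normal_cone F a"
    by (rule normal_cone_limit[rotated]) (use w(2) r(3) in auto)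
  then show ?thesis
    using r(1) by auto
qed

text \<open>Bolzano-Weierstrass in a finite product: each new index refines the subsequence found so
  far, which keeps the limits already obtained.\<close>

lemma family_convergent_subsequence:
  fixes v :: "nat \<Rightarrow> 'b \<Rightarrow> 'a::euclidean_space"
  assumes "finite I" "\<And>i n. i \<in> I \<Longrightarrow> norm (v n i) \<le> b"
  shows "\<exists>r y. strict_mono (r :: nat \<Rightarrow> nat) \<and> (\<forall>i\<in>I. (\<lambda>n. v (r n) i) \<longlonglongrightarrow> y i)"
  using assms
proof (induction I)
  case empty
  show ?case
    using strict_mono_id by auto
next
  case (insert j I)
  obtain r y where r: "strict_mono (r :: nat \<Rightarrow> nat)" "\<forall>i\<in>I. (\<lambda>n. v (r n) i) \<longlonglongrightarrow> y i"
    using insert by blast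
  have "compact (cball (0::'a) b)" "\<forall>n. v (r n) j \<in> cball 0 b"
    using insert.prems by auto
  then obtain l s where s: "strict_mono (s :: nat \<Rightarrow> nat)" "((\<lambda>n. v (r n) j) \<circ> s) \<longlonglongrightarrow> l"
    unfolding compact_def by metis
  have "(\<lambda>n. v (r (s n)) i) \<longlonglongrightarrow> (y(j := l)) i" if "i \<in> insert j I" for i
  proof (cases "i = j")
    case True
    then show ?thesis
      using s(2) by (simp add: o_def)
  next
    case False
    then show ?thesis
      using LIMSEQ_subseq_LIMSEQ[OF _ s(1), of "\<lambda>n. v (r n) i" "y i"] r(2) that by (simp add: o_def)
  qed
  moreover have "strict_mono (\<lambda>n. r (s n))"
    using strict_mono_o[OF r(1) s(1)] by (simp add: o_def)
  ultimately show ?case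
    by (intro exI[of _ "\<lambda>n. r (s n)"] exI[of _ "y(j := l)"]) auto
qed

text \<open>The common core of two arguments by contradiction. Proximal normals admit nonnegative
  scaling, so the families can be rescaled to product norm 1, and a convergent subsequence keeps
  that norm and the bound on the sum. It is used with \<open>\<alpha> n\<close> tending to 0 and
  with constant \<open>\<alpha>\<close>.\<close>

lemma normal_cone_compactness:
  fixes F :: "'b \<Rightarrow> 'a::euclidean_space set"
  assumes I: "finite I"
    and v: "\<And>n i. i \<in> I \<Longrightarrow> v n i \<in> proximal_normals (F i) a (1 / real (Suc n))"
    and pos: "\<And>n. 0 < l2_norm I (v n)"
    and le: "\<And>n. norm (\<Sum>i\<in>I. v n i) \<le> \<alpha> n * l2_norm I (v n)"
    and \<alpha>: "\<alpha> \<longlonglongrightarrow> l"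
  shows "\<exists>y. (\<forall>i\<in>I. y i \<in> normal_cone (F i) a) \<and> l2_norm I y = 1 \<and> norm (\<Sum>i\<in>I. y i) \<le> l"
proof -
  define s where "s n = inverse (l2_norm I (v n))" for n
  define w where "w n i = s n *\<^sub>R v n i" for n i
  have s: "0 < s n" "s n * l2_norm I (v n) = 1" for n
    using pos[of n] by (auto simp: s_def)
  have w1: "l2_norm I (w n) = 1" for n
    using s[of n] by (simp add: w_def[abs_def] l2_norm_scaleR)
  have wp: "w n i \<in> proximal_normals (F i) a (1 / real (Suc n))" if "i \<in> I" for n i
    unfolding w_def using v[OF that] s(1)[of n] by (intro proximal_normals_scaleR) auto
  have wl: "norm (\<Sum>i\<in>I. w n i) \<le> \<alpha> n" for n
  proof -
    have "norm (\<Sum>i\<in>I. w n i) = s n * norm (\<Sum>i\<in>I. v n i)"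
      using s(1)[of n] by (simp add: w_def scaleR_sum_right[symmetric])
    also have "\<dots> \<le> s n * (\<alpha> n * l2_norm I (v n))"
      using s(1)[of n] le[of n] by (intro mult_left_mono) auto
    also have "\<dots> = \<alpha> n * (s n * l2_norm I (v n))"
      by (simp only: mult.left_commute)
    finally show ?thesis
      by (simp only: s(2) mult_1_right)
  qed
  have "norm (w n i) \<le> 1" if "i \<in> I" for n i
    using norm_le_l2_norm[OF I that, of "w n"] w1 by simp
  then obtain r y where r: "strict_mono (r :: nat \<Rightarrow> nat)" "\<And>i. i \<in> I \<Longrightarrow> (\<lambda>n. w (r n) i) \<longlonglongrightarrow> y i"
    using family_convergent_subsequence[OF I] by metis
  have "(\<lambda>n. 1 / real (Suc (r n))) \<longlonglongrightarrow> 0"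
    using LIMSEQ_subseq_LIMSEQ[OF LIMSEQ_Suc[OF lim_1_over_n] r(1)] by (simp add: o_def)
  then have "y i \<in> normal_cone (F i) a" if "i \<in> I" for i
    by (rule normal_cone_limit[rotated, OF _ r(2)[OF that]]) (rule wp[OF that])
  moreover have "l2_norm I y = 1"
    using tendsto_l2_norm[of I "\<lambda>n. w (r n)" y] r(2) w1 by (simp add: LIMSEQ_const_iff)
  moreover have "norm (\<Sum>i\<in>I. y i) \<le> l"
  proof (rule LIMSEQ_le)
    show "(\<lambda>n. norm (\<Sum>i\<in>I. w (r n) i)) \<longlonglongrightarrow> norm (\<Sum>i\<in>I. y i)"
      by (intro tendsto_intros r(2))
    show "(\<lambda>n. \<alpha> (r n)) \<longlonglongrightarrow> l"
      using LIMSEQ_subseq_LIMSEQ[OF \<alpha> r(1)] by (simp add: o_def)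
  qed (use wl in blast)
  ultimately show ?thesis
    by blast
qed

text \<open>The form in which strong regularity enters the convergence proofs: families of proximal
  normals near \<open>a\<close> shrink by the factor \<open>c\<close> when their component along the
  diagonal is removed.\<close>

definition deviation_bound ::
    "'b set \<Rightarrow> ('b \<Rightarrow> 'a::euclidean_space set) \<Rightarrow> 'a \<Rightarrow> real \<Rightarrow> real \<Rightarrow> bool" where
  "deviation_bound I F a e c \<longleftrightarrow> (\<forall>v. (\<forall>i\<in>I. v i \<in> proximal_normals (F i) a e) \<longrightarrow>
    l2_norm I (\<lambda>i. v i - mean I v) \<le> c * l2_norm I v)"

lemma deviation_boundD:
  assumes "deviation_bound I F a e c" "\<And>i. i \<in> I \<Longrightarrow> v i \<in> proximal_normals (F i) a e"
  shows "l2_norm I (\<lambda>i. v i - mean I v) \<le> c * l2_norm I v"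
  using assms by (simp add: deviation_bound_def)

lemma deviation_bound_mono:
  fixes F :: "'b \<Rightarrow> 'a::euclidean_space set"
  assumes "deviation_bound I F a e c" "e' \<le> e"
  shows "deviation_bound I F a e' c"
proof -
  have "proximal_normals F a e' \<subseteq> proximal_normals F a e" for F :: "'a set"
    using assms(2) unfolding proximal_normals_def by (blast intro: less_le_trans)
  then show ?thesis
    using assms(1) unfolding deviation_bound_def by blast
qed

section \<open>The condition modulus\<close>

text \<open>These are the numbers whose infimum is \<open>cond_modulus\<close>, as
  \<open>cond_modulus_eq\<close> records.\<close>

definition regularity_constant ::
    "'b set \<Rightarrow> ('b \<Rightarrow> 'a::euclidean_space set) \<Rightarrow> 'a \<Rightarrow> real \<Rightarrow> bool" where
  "regularity_constant I F a k \<longleftrightarrow> 0 < k \<and>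
    (\<forall>y. (\<forall>i\<in>I. y i \<in> normal_cone (F i) a) \<longrightarrow> l2_norm I y \<le> k * norm (\<Sum>i\<in>I. y i))"

text \<open>Without a constant valid near \<open>a\<close>, normalized violating families would
  converge to normals of product norm 1 with sum zero, contradicting strong regularity. Thus the
  infimum defining the modulus ranges over a nonempty set.\<close>

lemma regularity_constant_exists:
  fixes F :: "'b \<Rightarrow> 'a::euclidean_space set"
  assumes I: "finite I"
    and reg: "\<And>y. (\<forall>i\<in>I. y i \<in> normal_cone (F i) a) \<Longrightarrow> (\<Sum>i\<in>I. y i) = 0 \<Longrightarrow> \<forall>i\<in>I. y i = 0"
  shows "\<exists>k. regularity_constant I F a k"
proof -
  \<comment> \<open>The same \<open>Suc n\<close> is the constant and the reciprocal of the radius,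
    so that a failure for every \<open>n\<close> gives a single sequence along which the radius and
    the relative size of the sum both tend to 0.\<close>
  have "\<exists>n. \<forall>v. (\<forall>i\<in>I. v i \<in> proximal_normals (F i) a (1 / real (Suc n))) \<longrightarrow>
      l2_norm I v \<le> real (Suc n) * norm (\<Sum>i\<in>I. v i)"
  proof (rule ccontr)
    assume "\<not> ?thesis"
    then have "\<exists>v. (\<forall>i\<in>I. v i \<in> proximal_normals (F i) a (1 / real (Suc n))) \<and>
        real (Suc n) * norm (\<Sum>i\<in>I. v i) < l2_norm I v" for n
      by (simp only: not_ex not_all not_imp not_le)
    then obtain v where v: "\<And>n i. i \<in> I \<Longrightarrow> v n i \<in> proximal_normals (F i) a (1 / real (Suc n))"
        "\<And>n. real (Suc n) * norm (\<Sum>i\<in>I. v n i) < l2_norm I (v n)"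
      by metis
    have pos: "0 < l2_norm I (v n)" for n
      by (rule le_less_trans[OF _ v(2)]) simp
    have le: "norm (\<Sum>i\<in>I. v n i) \<le> 1 / real (Suc n) * l2_norm I (v n)" for n
      using v(2)[of n] by (simp add: field_simps)
    obtain y where y: "\<forall>i\<in>I. y i \<in> normal_cone (F i) a" "l2_norm I y = 1" "norm (\<Sum>i\<in>I. y i) \<le> 0"
      using normal_cone_compactness[OF I v(1) pos le LIMSEQ_Suc[OF lim_1_over_n]] by blast
    then have "\<forall>i\<in>I. y i = 0"
      using reg by simp
    then have "l2_norm I y = 0"
      by (simp add: l2_norm_def L2_set_def)
    then show False
      using y(2) by simp
  qed
  then obtain n where n: "\<And>v. (\<forall>i\<in>I. v i \<in> proximal_normals (F i) a (1 / real (Suc n))) \<Longrightarrow>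
      l2_norm I v \<le> real (Suc n) * norm (\<Sum>i\<in>I. v i)"
    by blast
  \<comment> \<open>The inequality passes from proximal normals to their limits, since both sides
    are continuous.\<close>
  have "l2_norm I y \<le> real (Suc n) * norm (\<Sum>i\<in>I. y i)" if y: "\<forall>i\<in>I. y i \<in> normal_cone (F i) a" for y
  proof -
    have "\<exists>w. (\<forall>j. w j \<in> proximal_normals (F i) a (1 / real (Suc n))) \<and> w \<longlonglongrightarrow> y i" if "i \<in> I" for i
      using normal_cone_approx[of "y i" "F i" a "1 / real (Suc n)"] y that by simp
    then obtain w where w: "\<And>i j. i \<in> I \<Longrightarrow> w i j \<in> proximal_normals (F i) a (1 / real (Suc n))"
        "\<And>i. i \<in> I \<Longrightarrow> w i \<longlonglongrightarrow> y i"
      by metis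
    show ?thesis
    proof (rule LIMSEQ_le)
      show "(\<lambda>j. l2_norm I (\<lambda>i. w i j)) \<longlonglongrightarrow> l2_norm I y"
        by (rule tendsto_l2_norm) (rule w(2))
      show "(\<lambda>j. real (Suc n) * norm (\<Sum>i\<in>I. w i j)) \<longlonglongrightarrow> real (Suc n) * norm (\<Sum>i\<in>I. y i)"
        by (intro tendsto_intros w(2))
      have "l2_norm I (\<lambda>i. w i j) \<le> real (Suc n) * norm (\<Sum>i\<in>I. w i j)" for j
        by (rule n) (use w(1) in blast)
      then show "\<exists>N. \<forall>j\<ge>N. l2_norm I (\<lambda>i. w i j) \<le> real (Suc n) * norm (\<Sum>i\<in>I. w i j)"
        by blast
    qed
  qed
  then show ?thesis
    unfolding regularity_constant_def by (intro exI[of _ "real (Suc n)"]) simp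
qed

text \<open>If every radius failed, compactness would give a family of normals of norm 1 whose sum
  has norm at most \<open>1 / k'\<close>, whereas \<open>k\<close> forces this norm to be at least
  \<open>1 / k > 1 / k'\<close>.\<close>

lemma regularity_constant_nearby:
  fixes F :: "'b \<Rightarrow> 'a::euclidean_space set"
  assumes I: "finite I" and k: "regularity_constant I F a k" "k < k'"
  shows "\<exists>e>0. \<forall>v. (\<forall>i\<in>I. v i \<in> proximal_normals (F i) a e) \<longrightarrow>
      l2_norm I v \<le> k' * norm (\<Sum>i\<in>I. v i)"
proof (rule ccontr)
  assume neg: "\<not> ?thesis"
  have k': "0 < k" "0 < k'"
    using k by (auto simp: regularity_constant_def)
  have "\<exists>v. (\<forall>i\<in>I. v i \<in> proximal_normals (F i) a (1 / real (Suc n))) \<and>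
      k' * norm (\<Sum>i\<in>I. v i) < l2_norm I v" for n
    using neg[unfolded not_ex, THEN spec, of "1 / real (Suc n)"] by (simp add: not_le)
  then obtain v where v: "\<And>n i. i \<in> I \<Longrightarrow> v n i \<in> proximal_normals (F i) a (1 / real (Suc n))"
      "\<And>n. k' * norm (\<Sum>i\<in>I. v n i) < l2_norm I (v n)"
    by metis
  have pos: "0 < l2_norm I (v n)" for n
    by (rule le_less_trans[OF _ v(2)]) (use k' in simp)
  have le: "norm (\<Sum>i\<in>I. v n i) \<le> 1 / k' * l2_norm I (v n)" for n
    using v(2)[of n] k' by (simp add: field_simps)
  obtain y where y: "\<forall>i\<in>I. y i \<in> normal_cone (F i) a" "l2_norm I y = 1" "norm (\<Sum>i\<in>I. y i) \<le> 1 / k'"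
    using normal_cone_compactness[OF I v(1) pos le tendsto_const] by blast
  have "1 \<le> k * norm (\<Sum>i\<in>I. y i)"
    using k(1) y(1,2) by (metis regularity_constant_def)
  also have "\<dots> \<le> k * (1 / k')"
    using y(3) k' by (intro mult_left_mono) auto
  also have "\<dots> < 1"
    using k' k(2) by simp
  finally show False
    by simp
qed

text \<open>Testing with a unit normal in the single coordinate \<open>j\<close> already gives
  \<open>1 \<le> k\<close>. The form with the square root is what makes
  \<open>1 - 1 / (m * k^2)\<close> nonnegative.\<close>

lemma regularity_constant_lower_bound:
  fixes F :: "'b \<Rightarrow> 'a::euclidean_space set"
  assumes I: "finite I" and F: "\<And>i. i \<in> I \<Longrightarrow> closed (F i)" "\<And>i. i \<in> I \<Longrightarrow> a \<in> F i"
    and j: "j \<in> I" "a \<notin> interior (F j)" and k: "regularity_constant I F a k"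
  shows "1 / sqrt (real (card I)) \<le> k"
proof -
  obtain v where v: "v \<in> normal_cone (F j) a" "norm v = 1"
    using exists_unit_normal[OF F(1)[OF j(1)] F(2)[OF j(1)] j(2)] by blast
  define y where "y = (\<lambda>i. if i = j then v else 0)"
  have "\<forall>i\<in>I. y i \<in> normal_cone (F i) a"
    using v(1) zero_in_normal_cone[OF F(2)] by (simp add: y_def)
  then have "l2_norm I y \<le> k * norm (\<Sum>i\<in>I. y i)"
    using k unfolding regularity_constant_def by blast
  also have "(\<Sum>i\<in>I. y i) = v"
    using I j(1) by (simp add: y_def)
  finally have "l2_norm I y \<le> k"
    using v(2) by simp
  moreover have "1 \<le> l2_norm I y"
    using norm_le_l2_norm[OF I j(1), of y] v(2) by (simp add: y_def)
  moreover have "1 \<le> card I"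
    using I j(1) card_gt_0_iff[of I] by (simp add: Suc_le_eq) blast
  then have "1 / sqrt (real (card I)) \<le> 1"
    by simp
  ultimately show ?thesis
    by linarith
qed

lemma proximal_normals_interior:
  assumes "ball a e \<subseteq> F" "v \<in> proximal_normals F a e"
  shows "v = 0"
proof -
  obtain t u z where *: "v = t *\<^sub>R (u - z)" "dist u a < e" "z \<in> metric_projection F u"
    using assms(2) by (auto simp: proximal_normals_def)
  then have "u \<in> F"
    using assms(1) by (auto simp: dist_commute)
  then show ?thesis
    using * metric_projection_self by force
qed

lemma cond_modulus_eq: "cond_modulus m F a = Inf {k. regularity_constant {1..m} F a k}"
  by (simp add: cond_modulus_def regularity_constant_def l2_norm_def L2_set_def)

lemma strongly_regular_intersection_constant:
  assumes "strongly_regular_intersection m F a"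
  shows "\<exists>k. regularity_constant {1..m} F a k"
proof (rule regularity_constant_exists)
  show "\<forall>i\<in>{1..m}. y i = 0"
    if "\<forall>i\<in>{1..m}. y i \<in> normal_cone (F i) a" "(\<Sum>i\<in>{1..m}. y i) = 0" for y
    using assms that unfolding strongly_regular_intersection_def by blast
qed (rule finite_atLeastAtMost)

lemma cond_modulus_lower_bound:
  assumes "1 \<le> m" and reg: "strongly_regular_intersection m F a"
    and F: "\<And>i. i \<in> {1..m} \<Longrightarrow> closed (F i)" "\<And>i. i \<in> {1..m} \<Longrightarrow> a \<in> F i"
    and j: "a \<notin> (\<Inter>i\<in>{1..m}. interior (F i))"
  shows "1 \<le> real m * (cond_modulus m F a)\<^sup>2" "0 < cond_modulus m F a"
proof -
  obtain j where "j \<in> {1..m}" "a \<notin> interior (F j)"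
    using j by blast
  then have "1 / sqrt (real m) \<le> k" if "regularity_constant {1..m} F a k" for k
    using regularity_constant_lower_bound[OF _ F _ _ that] by simp
  then have le: "1 / sqrt (real m) \<le> cond_modulus m F a"
    unfolding cond_modulus_eq using strongly_regular_intersection_constant[OF reg]
    by (intro cInf_greatest) auto
  then have "(1 / sqrt (real m))\<^sup>2 \<le> (cond_modulus m F a)\<^sup>2"
    by (intro power_mono) auto
  then show "1 \<le> real m * (cond_modulus m F a)\<^sup>2"
    using assms(1) by (simp add: power_divide field_simps)
  have "0 < 1 / sqrt (real m)"
    using assms(1) by simp
  then show "0 < cond_modulus m F a"
    using le by linarith
qed

text \<open>At an interior point all nearby proximal normals vanish. Otherwise the relation between
  \<open>c\<close> and the modulus is inverted: a constant slightly above the modulus works for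
  proximal normals near \<open>a\<close>, and Pythagoras converts it into the factor
  \<open>c\<close>.\<close>

lemma deviation_bound_nearby:
  fixes F :: "nat \<Rightarrow> 'a::euclidean_space set"
  assumes m: "1 \<le> m" and reg: "strongly_regular_intersection m F a"
    and F: "\<And>i. i \<in> {1..m} \<Longrightarrow> closed (F i)" "\<And>i. i \<in> {1..m} \<Longrightarrow> a \<in> F i"
    and c: "0 < c" "c < 1"
      "(if a \<in> (\<Inter>i\<in>{1..m}. interior (F i)) then 0
        else 1 - 1 / (real m * (cond_modulus m F a)\<^sup>2)) < c\<^sup>2"
  shows "\<exists>e>0. deviation_bound {1..m} F a e c"
proof (cases "a \<in> (\<Inter>i\<in>{1..m}. interior (F i))")
  case True
  have "open (\<Inter>i\<in>{1..m}. interior (F i))"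
    by (intro open_INT) auto
  then obtain e where e: "e > 0" "ball a e \<subseteq> (\<Inter>i\<in>{1..m}. interior (F i))"
    by (rule openE[OF _ True])
  have "l2_norm {1..m} (\<lambda>i. v i - mean {1..m} v) \<le> c * l2_norm {1..m} v"
    if "\<forall>i\<in>{1..m}. v i \<in> proximal_normals (F i) a e" for v
  proof -
    have "v i = 0" if i: "i \<in> {1..m}" for i
    proof (rule proximal_normals_interior)
      show "ball a e \<subseteq> F i"
        using e(2) i interior_subset by blast
      show "v i \<in> proximal_normals (F i) a e"
        using i \<open>\<forall>i\<in>{1..m}. v i \<in> proximal_normals (F i) a e\<close> by blast
    qed
    then show ?thesis
      by (simp add: l2_norm_def L2_set_def mean_def)
  qed
  then show ?thesis
    using e(1) unfolding deviation_bound_def by blast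
next
  case False
  define K where "K = cond_modulus m F a"
  \<comment> \<open>Solves \<open>c^2 = 1 - 1 / (m * k'^2)\<close>; the hypothesis on
    \<open>c\<close> then says exactly that \<open>k'\<close> exceeds the modulus.\<close>
  define k' where "k' = 1 / sqrt (real m * (1 - c\<^sup>2))"
  have K: "0 < K"
    unfolding K_def using cond_modulus_lower_bound(2)[OF m reg F False] by simp
  have c2: "0 < real m * (1 - c\<^sup>2)"
    using c(1,2) m by (simp add: power_less_one_iff)
  have cancel: "p * (1 / p * q) = q" if "0 < p" for p q :: real
    using that by simp
  have k'2: "k'\<^sup>2 = 1 / (real m * (1 - c\<^sup>2))" and k'0: "0 < k'"
    using c2 by (simp_all add: k'_def power_divide)
  have "1 - 1 / (real m * K\<^sup>2) < c\<^sup>2"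
    using c(3) by (simp only: False if_False K_def)
  then have "real m * (1 - c\<^sup>2) * K\<^sup>2 < 1"
    using K m by (simp add: field_simps)
  then have "K\<^sup>2 < k'\<^sup>2"
    unfolding k'2 using c2 by (simp add: field_simps)
  then have "K < k'"
    by (rule power2_less_imp_less[OF _ less_imp_le[OF k'0]])
  then have lt: "Inf {k. regularity_constant {1..m} F a k} < k'"
    by (simp only: K_def cond_modulus_eq)
  \<comment> \<open>Over the empty set \<open>Inf\<close> would be an unspecified real; nonemptiness
    is what lets an admissible \<open>k\<close> be chosen below \<open>k'\<close>.\<close>
  have "{k. regularity_constant {1..m} F a k} \<noteq> {}"
    using strongly_regular_intersection_constant[OF reg] by blast
  from cInf_lessD[OF this lt] obtain k where k: "regularity_constant {1..m} F a k" "k < k'"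
    by blast
  obtain e where e: "0 < e" "\<And>v. (\<forall>i\<in>{1..m}. v i \<in> proximal_normals (F i) a e) \<Longrightarrow>
      l2_norm {1..m} v \<le> k' * norm (\<Sum>i\<in>{1..m}. v i)"
    using regularity_constant_nearby[OF _ k] by blast
  have "l2_norm {1..m} (\<lambda>i. v i - mean {1..m} v) \<le> c * l2_norm {1..m} v"
    if "\<forall>i\<in>{1..m}. v i \<in> proximal_normals (F i) a e" for v
  proof (rule l2_norm_deviation_le)
    have "(l2_norm {1..m} v)\<^sup>2 \<le> (k' * norm (\<Sum>i\<in>{1..m}. v i))\<^sup>2"
      using e(2)[OF that] by (intro power_mono) auto
    then have "(l2_norm {1..m} v)\<^sup>2 \<le> 1 / (real m * (1 - c\<^sup>2)) * (norm (\<Sum>i\<in>{1..m}. v i))\<^sup>2"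
      by (simp only: power_mult_distrib k'2)
    then have "(real m * (1 - c\<^sup>2)) * (l2_norm {1..m} v)\<^sup>2 \<le>
        (real m * (1 - c\<^sup>2)) * (1 / (real m * (1 - c\<^sup>2)) * (norm (\<Sum>i\<in>{1..m}. v i))\<^sup>2)"
      by (rule mult_left_mono[OF _ less_imp_le[OF c2]])
    also have "\<dots> = (norm (\<Sum>i\<in>{1..m}. v i))\<^sup>2"
      using cancel[OF c2] .
    finally show "real (card {1..m}) * (1 - c\<^sup>2) * (l2_norm {1..m} v)\<^sup>2 \<le> (norm (\<Sum>i\<in>{1..m}. v i))\<^sup>2"
      by simp
  qed (use m c(1) in simp_all)
  then show ?thesis
    using e(1) unfolding deviation_bound_def by blast
qed

section \<open>Linear convergence\<close>

text \<open>The contraction is available only while successive iterates stay in the ball of radius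
  \<open>e\<close>. The hypothesis \<open>init\<close> bounds the starting distance plus the sum of
  the whole geometric series of steps, so the iterates never leave that ball.\<close>

lemma geometric_steps_R_linear:
  fixes x :: "nat \<Rightarrow> 'a::euclidean_space"
  assumes r: "0 < r" "r < 1"
    and step: "\<And>n. norm (x (Suc n) - x n) \<le> D n"
    and contr: "\<And>n. dist (x n) a < e \<Longrightarrow> dist (x (Suc n)) a < e \<Longrightarrow> D (Suc n) \<le> r * D n"
    and init: "dist (x 0) a + D 0 / (1 - r) < e"
  shows "\<exists>xhat. R_linear_convergence x xhat r \<and> x \<longlonglongrightarrow> xhat \<and> D \<longlonglongrightarrow> 0 \<and>
    dist xhat a \<le> dist (x 0) a + D 0 / (1 - r)"
proof -
  define C where "C = D 0 / (1 - r)"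
  have D_nonneg: "0 \<le> D n" for n
    by (rule order_trans[OF norm_ge_zero step])
  have C: "0 \<le> C" "D 0 = C * (1 - r)"
    using r D_nonneg[of 0] by (simp_all add: C_def)
  have near: "dist (x n) a < e" if "dist (x n) (x 0) \<le> C * (1 - r ^ n)" for n
  proof -
    have "C * (1 - r ^ n) \<le> C * 1"
      using C(1) r by (intro mult_left_mono) auto
    then show ?thesis
      using that init dist_triangle[of "x n" a "x 0"] by (simp add: C_def)
  qed
  \<comment> \<open>\<open>C * (1 - r ^ n)\<close> is the sum of the first \<open>n\<close> terms of
    the series \<open>D 0 * r ^ k\<close>. In the induction step the distance bound for
    \<open>Suc n\<close> comes first, because the contraction needs both iterates near
    \<open>a\<close>.\<close>
  have inv: "D n \<le> D 0 * r ^ n \<and> dist (x n) (x 0) \<le> C * (1 - r ^ n)" for n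
  proof (induction n)
    case (Suc n)
    have "dist (x (Suc n)) (x 0) \<le> D n + dist (x n) (x 0)"
      using dist_triangle[of "x (Suc n)" "x 0" "x n"] step[of n] by (simp add: dist_norm)
    also have "\<dots> \<le> C * (1 - r) * r ^ n + C * (1 - r ^ n)"
      using Suc C(2) by simp
    also have "\<dots> = C * (1 - r ^ Suc n)"
      by (simp add: algebra_simps)
    finally have d: "dist (x (Suc n)) (x 0) \<le> C * (1 - r ^ Suc n)" .
    have "D (Suc n) \<le> r * D n"
      using contr near d Suc by blast
    also have "\<dots> \<le> r * (D 0 * r ^ n)"
      using Suc r by (intro mult_left_mono) auto
    finally show ?case
      using d by (simp add: mult_ac)
  qed (simp)
  \<comment> \<open>The same partial sums, started at index \<open>n\<close>; letting
    \<open>k\<close> grow gives both the Cauchy property and the rate.\<close>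
  have tail: "dist (x (n + k)) (x n) \<le> C * (1 - r ^ k) * r ^ n" for n k
  proof (induction k)
    case (Suc k)
    have "dist (x (n + Suc k)) (x n) \<le> D (n + k) + dist (x (n + k)) (x n)"
      using dist_triangle[of "x (n + Suc k)" "x n" "x (n + k)"] step[of "n + k"]
      by (simp add: dist_norm)
    also have "\<dots> \<le> C * (1 - r) * r ^ (n + k) + C * (1 - r ^ k) * r ^ n"
      using Suc inv[of "n + k"] C(2) by simp
    also have "\<dots> = C * (1 - r ^ Suc k) * r ^ n"
      by (simp add: algebra_simps power_add)
    finally show ?case .
  qed simp
  have tail': "dist (x (n + k)) (x n) \<le> C * r ^ n" for n k
  proof -
    have "C * (1 - r ^ k) * r ^ n \<le> C * 1 * r ^ n"
      using C(1) r by (intro mult_right_mono mult_left_mono) auto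
    then show ?thesis
      using tail[of n k] by simp
  qed
  have r0: "(\<lambda>n. r ^ n) \<longlonglongrightarrow> 0"
    using r by (intro LIMSEQ_power_zero) simp
  have "Cauchy x"
  proof (rule metric_CauchyI)
    fix \<epsilon> :: real assume "0 < \<epsilon>"
    moreover have "(\<lambda>n. 2 * (C * r ^ n)) \<longlonglongrightarrow> 0"
      using tendsto_mult_right_zero[OF r0, of "2 * C"] by (simp add: mult_ac)
    ultimately obtain N where N: "2 * (C * r ^ N) < \<epsilon>"
      by (metis (no_types, lifting) eventually_sequentially order_refl order_tendstoD(2))
    have "dist (x i) (x j) < \<epsilon>" if "i \<ge> N" "j \<ge> N" for i j
      using tail'[of N "i - N"] tail'[of N "j - N"] that N dist_triangle2[of "x i" "x j" "x N"] by simp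
    then show "\<exists>M. \<forall>i\<ge>M. \<forall>j\<ge>M. dist (x i) (x j) < \<epsilon>"
      by blast
  qed
  then obtain xhat where lim: "x \<longlonglongrightarrow> xhat"
    using Cauchy_convergent convergent_def by blast
  have rate: "dist xhat (x n) \<le> C * r ^ n" for n
  proof (rule LIMSEQ_le_const2)
    show "(\<lambda>k. dist (x (k + n)) (x n)) \<longlonglongrightarrow> dist xhat (x n)"
      by (intro tendsto_intros LIMSEQ_ignore_initial_segment lim)
  qed (use tail'[of n] in \<open>simp add: add.commute\<close>)
  have "R_linear_convergence x xhat r"
    unfolding R_linear_convergence_def using r rate by (metis dist_commute dist_norm)
  moreover have "D \<longlonglongrightarrow> 0"
  proof (rule tendsto_sandwich[of "\<lambda>_. 0" D sequentially "\<lambda>n. D 0 * r ^ n" 0])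
    show "(\<lambda>n. D 0 * r ^ n) \<longlonglongrightarrow> 0"
      by (rule tendsto_mult_right_zero[OF r0])
    show "\<forall>\<^sub>F n in sequentially. 0 \<le> D n" "\<forall>\<^sub>F n in sequentially. D n \<le> D 0 * r ^ n"
      using D_nonneg inv by simp_all
  qed (rule tendsto_const)
  moreover have "dist xhat a \<le> dist (x 0) a + D 0 / (1 - r)"
    using rate[of 0] dist_triangle[of xhat a "x 0"] by (simp add: C_def)
  ultimately show ?thesis
    using lim by blast
qed

text \<open>The product residual majorizes the steps and contracts. Since it tends to 0, the
  projections have the same limit as the iterates, and closedness puts that limit in every set. The
  points \<open>p i\<close> may differ from set to set: no common point of the \<open>G i\<close> is
  presupposed, which is essential for translated sets.\<close>

lemma averaged_projections_convergence:
  fixes G :: "nat \<Rightarrow> 'a::euclidean_space set"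
  assumes m: "1 \<le> m" and G: "\<And>i. i \<in> {1..m} \<Longrightarrow> closed (G i)" "\<And>i. i \<in> {1..m} \<Longrightarrow> p i \<in> G i"
    and r: "0 < r" "r < 1"
    and contr: "\<And>u z z'. (\<And>i. i \<in> {1..m} \<Longrightarrow> z i \<in> metric_projection (G i) u) \<Longrightarrow>
        (\<And>i. i \<in> {1..m} \<Longrightarrow> z' i \<in> metric_projection (G i) (mean {1..m} z)) \<Longrightarrow>
        dist u a < e \<Longrightarrow> dist (mean {1..m} z) a < e \<Longrightarrow>
        l2_norm {1..m} (\<lambda>i. mean {1..m} z - z' i) \<le> r * l2_norm {1..m} (\<lambda>i. u - z i)"
    and x: "averaged_projections m G x"
    and init: "dist (x 0) a + l2_norm {1..m} (\<lambda>i. x 0 - p i) / (1 - r) < e"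
  shows "\<exists>xhat \<in> (\<Inter>i\<in>{1..m}. G i). R_linear_convergence x xhat r \<and>
    dist xhat a \<le> dist (x 0) a + l2_norm {1..m} (\<lambda>i. x 0 - p i) / (1 - r)"
proof -
  have fin: "finite {1..m}" "{1..m} \<noteq> {}"
    using m by auto
  obtain z where "\<forall>n. (\<forall>i\<in>{1..m}. z n i \<in> metric_projection (G i) (x n)) \<and>
      x (Suc n) = (1 / real m) *\<^sub>R (\<Sum>i=1..m. z n i)"
    using x unfolding averaged_projections_def by blast
  then have z: "\<And>n i. i \<in> {1..m} \<Longrightarrow> z n i \<in> metric_projection (G i) (x n)"
      and x': "\<And>n. x (Suc n) = mean {1..m} (z n)"
    by (simp_all add: mean_def)
  define D where "D n = l2_norm {1..m} (\<lambda>i. x n - z n i)" for n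
  have step: "norm (x (Suc n) - x n) \<le> D n" for n
    using norm_mean_le[OF fin, of "\<lambda>i. x n - z n i"]
    by (simp add: D_def x' mean_const_diff[OF fin] norm_minus_commute del: One_nat_def)
  have c: "D (Suc n) \<le> r * D n" if "dist (x n) a < e" "dist (x (Suc n)) a < e" for n
  proof -
    have mem: "z (Suc n) i \<in> metric_projection (G i) (mean {1..m} (z n))" if "i \<in> {1..m}" for i
      using z[OF that, of "Suc n"] by (simp only: x')
    have near: "dist (mean {1..m} (z n)) a < e"
      using that(2) by (simp only: x')
    show ?thesis
      unfolding D_def x' by (rule contr[OF z mem that(1) near])
  qed
  have "D 0 \<le> l2_norm {1..m} (\<lambda>i. x 0 - p i)"
    unfolding D_def by (rule l2_norm_mono) (rule metric_projection_le[OF z G(2)])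
  then have D0: "dist (x 0) a + D 0 / (1 - r) \<le> dist (x 0) a + l2_norm {1..m} (\<lambda>i. x 0 - p i) / (1 - r)"
    using r by (simp add: divide_right_mono)
  then have "dist (x 0) a + D 0 / (1 - r) < e"
    using init by linarith
  then obtain xhat where xh: "R_linear_convergence x xhat r" "x \<longlonglongrightarrow> xhat" "D \<longlonglongrightarrow> 0"
      "dist xhat a \<le> dist (x 0) a + D 0 / (1 - r)"
    using geometric_steps_R_linear[of r x D, OF r step c] by blast
  have "xhat \<in> G i" if i: "i \<in> {1..m}" for i
  proof (rule closed_sequentially[OF G(1)[OF i]])
    show "z n i \<in> G i" for n
      using z[OF i] metric_projection_mem by blast
    have "dist (x n) (z n i) \<le> dist (D n) 0" for n
      using norm_le_l2_norm[OF fin(1) i, of "\<lambda>i. x n - z n i"] by (simp add: D_def dist_norm)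
    then have "(\<lambda>n. x n - z n i) \<longlonglongrightarrow> 0"
      by (intro metric_tendsto_imp_tendsto[OF xh(3)] always_eventually) (simp add: dist_norm)
    from tendsto_diff[OF xh(2) this] show "(\<lambda>n. z n i) \<longlonglongrightarrow> xhat"
      by simp
  qed
  then show ?thesis
    using xh(1,4) D0 by force
qed

section \<open>One-step contraction estimates\<close>

lemma translated_projection_deviation:
  fixes F :: "'b \<Rightarrow> 'a::euclidean_space set"
  assumes fin: "finite I" "I \<noteq> {}"
    and dev: "deviation_bound I F a e c"
    and z: "\<And>i. i \<in> I \<Longrightarrow> z i \<in> metric_projection ((+) (d i) ` F i) u"
    and near: "\<And>i. i \<in> I \<Longrightarrow> dist u a + norm (d i) < e"
  shows "l2_norm I (\<lambda>i. mean I z - z i) \<le> c * l2_norm I (\<lambda>i. u - z i)"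
proof -
  have "u - z i \<in> proximal_normals (F i) a e" if "i \<in> I" for i
  proof -
    have "dist (u - d i) a < e"
      using near[OF that] norm_triangle_ineq4[of "u - a" "d i"] by (simp add: dist_norm algebra_simps)
    from proximal_normals_diff[OF this metric_projection_translation[OF z[OF that]]]
    show ?thesis
      by simp
  qed
  from deviation_boundD[where v = "\<lambda>i. u - z i", OF dev this] show ?thesis
    by (simp add: mean_const_diff[OF fin])
qed

text \<open>The old projections \<open>z i\<close> still lie in the sets, so the new residuals are
  no longer than the distances from the mean to them, and these form the deviation of the old
  residuals.\<close>

lemma translated_projection_contraction:
  fixes F :: "'b \<Rightarrow> 'a::euclidean_space set"
  assumes fin: "finite I" "I \<noteq> {}"
    and dev: "deviation_bound I F a e c"
    and z: "\<And>i. i \<in> I \<Longrightarrow> z i \<in> metric_projection ((+) (d i) ` F i) u"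
    and z': "\<And>i. i \<in> I \<Longrightarrow> z' i \<in> metric_projection ((+) (d i) ` F i) (mean I z)"
    and near: "\<And>i. i \<in> I \<Longrightarrow> dist u a + norm (d i) < e"
  shows "l2_norm I (\<lambda>i. mean I z - z' i) \<le> c * l2_norm I (\<lambda>i. u - z i)"
proof -
  have "l2_norm I (\<lambda>i. mean I z - z' i) \<le> l2_norm I (\<lambda>i. mean I z - z i)"
    by (intro l2_norm_mono metric_projection_le[OF z'] metric_projection_mem[OF z])
  also have "\<dots> \<le> c * l2_norm I (\<lambda>i. u - z i)"
    by (rule translated_projection_deviation[OF fin dev z near])
  finally show ?thesis .
qed

lemma super_regular_uniform:
  assumes "finite I" "\<And>i. i \<in> I \<Longrightarrow> super_regular (F i) a" "0 < \<delta>"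
  shows "\<exists>e>0. \<forall>i\<in>I. \<forall>u z y. dist u a < e \<longrightarrow> dist z a < e \<longrightarrow> z \<in> F i \<longrightarrow>
    y \<in> metric_projection (F i) u \<longrightarrow>
    inner (z - y) (u - y) \<le> \<delta> * norm (z - y) * norm (u - y)"
proof -
  have "\<forall>i\<in>I. \<exists>U. open U \<and> a \<in> U \<and>
      (\<forall>u\<in>U. \<forall>z\<in>U \<inter> F i. \<forall>y\<in>metric_projection (F i) u.
         inner (z - y) (u - y) \<le> \<delta> * norm (z - y) * norm (u - y))"
    using assms(2,3) unfolding super_regular_def by blast
  from bchoice[OF this] obtain U where U: "\<forall>i\<in>I. open (U i) \<and> a \<in> U i \<and>
      (\<forall>u\<in>U i. \<forall>z\<in>U i \<inter> F i. \<forall>y\<in>metric_projection (F i) u.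
         inner (z - y) (u - y) \<le> \<delta> * norm (z - y) * norm (u - y))" ..
  have "open (\<Inter>i\<in>I. U i)" "a \<in> (\<Inter>i\<in>I. U i)"
    using U assms(1) by auto
  then obtain e where e: "e > 0" "ball a e \<subseteq> (\<Inter>i\<in>I. U i)"
    by (rule openE)
  have "inner (z - y) (u - y) \<le> \<delta> * norm (z - y) * norm (u - y)"
    if "i \<in> I" "dist u a < e" "dist z a < e" "z \<in> F i" "y \<in> metric_projection (F i) u" for i u z y
  proof -
    have "u \<in> U i" "z \<in> U i"
      using e(2) that(1-3) by (auto simp: subset_iff dist_commute)
    then show ?thesis
      using U that by blast
  qed
  then show ?thesis
    using e(1) by blast
qed

text \<open>One factor \<open>c\<close> is the deviation of the old residuals. The second arises by
  summing the super-regularity inequality for the old projections \<open>z i\<close> against the new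
  projections \<open>z' i\<close>: this controls the squared new residual by its pairing with
  \<open>q\<close>, which sees only the deviation of \<open>w\<close>.\<close>

lemma super_regular_contraction:
  fixes F :: "'b \<Rightarrow> 'a::euclidean_space set"
  assumes fin: "finite I" "I \<noteq> {}" and a: "\<And>i. i \<in> I \<Longrightarrow> a \<in> F i" and c: "0 \<le> c" and \<delta>: "0 \<le> \<delta>"
    and dev: "deviation_bound I F a e c"
    and sr: "\<And>i u z y. i \<in> I \<Longrightarrow> dist u a < e \<Longrightarrow> dist z a < e \<Longrightarrow> z \<in> F i \<Longrightarrow>
      y \<in> metric_projection (F i) u \<Longrightarrow>
      inner (z - y) (u - y) \<le> \<delta> * norm (z - y) * norm (u - y)"
    and z: "\<And>i. i \<in> I \<Longrightarrow> z i \<in> metric_projection (F i) u"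
    and z': "\<And>i. i \<in> I \<Longrightarrow> z' i \<in> metric_projection (F i) (mean I z)"
    and near: "dist u a < e / 2" "dist (mean I z) a < e / 2"
  shows "l2_norm I (\<lambda>i. mean I z - z' i) \<le> (c + 2 * \<delta>) * c * l2_norm I (\<lambda>i. u - z i)"
proof -
  have e: "dist u a < e" "dist (mean I z) a < e"
    using near zero_le_dist[of u a] zero_le_dist[of "mean I z" a] by linarith+
  define x w q A D where "x = mean I z" and "w = (\<lambda>i. x - z' i)" and "q = (\<lambda>i. z i - x)"
    and "A = l2_norm I q" and "D = l2_norm I w"
  have A: "A = l2_norm I (\<lambda>i. x - z i)"
    unfolding A_def q_def by (rule l2_norm_cong) (rule norm_minus_commute)
  have "l2_norm I (\<lambda>i. (u - z i) - mean I (\<lambda>i. u - z i)) \<le> c * l2_norm I (\<lambda>i. u - z i)"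
    by (intro deviation_boundD[OF dev] proximal_normals_diff[OF e(1) z])
  then have A_le: "A \<le> c * l2_norm I (\<lambda>i. u - z i)"
    by (simp add: A mean_const_diff[OF fin] x_def)
  have D_le: "D \<le> A"
    unfolding A D_def w_def x_def by (intro l2_norm_mono metric_projection_le[OF z'] metric_projection_mem[OF z])
  have dev_w: "l2_norm I (\<lambda>i. w i - mean I w) \<le> c * D"
    unfolding D_def w_def x_def by (intro deviation_boundD[OF dev] proximal_normals_diff[OF e(2) z'])
  have "(\<Sum>i\<in>I. inner (q i + w i) (w i)) \<le> (\<Sum>i\<in>I. \<delta> * (norm (q i + w i) * norm (w i)))"
  proof (rule sum_mono)
    fix i assume i: "i \<in> I"
    \<comment> \<open>As \<open>a\<close> lies in \<open>F i\<close>, the projection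
      \<open>z i\<close> is no farther from \<open>u\<close> than \<open>a\<close> is. This is why
      \<open>near\<close> uses half the radius.\<close>
    have "dist (z i) a \<le> dist (z i) u + dist u a"
      by (rule dist_triangle)
    also have "\<dots> < e"
      using metric_projection_le[OF z[OF i] a[OF i]] near(1) by (simp add: dist_norm norm_minus_commute)
    finally have "inner (z i - z' i) (x - z' i) \<le> \<delta> * norm (z i - z' i) * norm (x - z' i)"
      using sr[OF i e(2) _ metric_projection_mem[OF z[OF i]] z'[OF i]] by (simp add: x_def)
    then show "inner (q i + w i) (w i) \<le> \<delta> * (norm (q i + w i) * norm (w i))"
      by (simp add: q_def w_def mult.assoc)
  qed
  also have "\<dots> \<le> \<delta> * (l2_norm I (\<lambda>i. q i + w i) * D)"
    unfolding sum_distrib_left[symmetric] D_def by (intro mult_left_mono sum_norm_mult_le \<delta>)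
  also have "\<dots> \<le> \<delta> * ((A + D) * D)"
    using \<delta> l2_norm_triangle[of I q w] by (intro mult_left_mono mult_right_mono) (auto simp: A_def D_def)
  also have "\<dots> \<le> \<delta> * ((A + A) * D)"
    using \<delta> D_le by (intro mult_left_mono mult_right_mono) (auto simp: D_def)
  finally have up: "(\<Sum>i\<in>I. inner (q i + w i) (w i)) \<le> 2 * \<delta> * A * D"
    by (simp add: algebra_simps)
  \<comment> \<open>\<^term>\<open>q\<close> is orthogonal to the constant families, so only the deviation of \<^term>\<open>w\<close> matters.\<close>
  have "(\<Sum>i\<in>I. q i) = 0"
    using sum_eq_card_mean[OF fin, of z] by (simp add: q_def x_def sum_subtractf sum_constant_scaleR)
  then have "- (\<Sum>i\<in>I. inner (q i) (w i)) = (\<Sum>i\<in>I. inner (- q i) (w i - mean I w))"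
    by (simp add: inner_diff_right sum_subtractf inner_sum_left[symmetric] sum_negf)
  also have "\<dots> \<le> l2_norm I (\<lambda>i. - q i) * l2_norm I (\<lambda>i. w i - mean I w)"
    by (rule sum_inner_le)
  also have "\<dots> \<le> A * (c * D)"
    using dev_w by (intro mult_mono) (auto simp: A_def l2_norm_def)
  finally have "D\<^sup>2 \<le> A * (c * D) + 2 * \<delta> * A * D"
    using up by (simp add: inner_add_left sum.distrib D_def l2_norm_power2 power2_norm_eq_inner)
  then have "D * D \<le> ((c + 2 * \<delta>) * A) * D"
    by (simp add: power2_eq_square algebra_simps)
  moreover have "0 \<le> D" "0 \<le> (c + 2 * \<delta>) * A"
    using c \<delta> by (auto simp: A_def D_def)
  \<comment> \<open>Division by \<open>D\<close>; for \<open>D = 0\<close> the bound holds because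
    its right side is nonnegative.\<close>
  ultimately have "D \<le> (c + 2 * \<delta>) * A"
    by (cases "D = 0") auto
  also have "\<dots> \<le> (c + 2 * \<delta>) * (c * l2_norm I (\<lambda>i. u - z i))"
    using A_le c \<delta> by (intro mult_left_mono) auto
  finally show ?thesis
    by (simp add: D_def w_def x_def mult.assoc)
qed

section \<open>Local convergence from a deviation bound\<close>

text \<open>Shifts of the sets and of the initial point are allowed together, so that one statement
  serves the unperturbed claim, with all \<open>d i\<close> zero, and the perturbed one, with
  \<open>x 0 = a\<close>.\<close>

lemma perturbed_averaged_projections_convergence:
  fixes F :: "nat \<Rightarrow> 'a::euclidean_space set"
  assumes m: "1 \<le> m" and F: "\<And>i. i \<in> {1..m} \<Longrightarrow> closed (F i)" "\<And>i. i \<in> {1..m} \<Longrightarrow> a \<in> F i"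
    and c: "0 < c" "c < 1" and dev: "deviation_bound {1..m} F a e c" and "0 < e" "0 < \<rho>"
  shows "\<exists>\<eta>>0. \<forall>d x. (\<forall>i\<in>{1..m}. norm (d i) < \<eta>) \<and> dist (x 0) a < \<eta> \<and>
      averaged_projections m (\<lambda>i. (+) (d i) ` F i) x \<longrightarrow>
    (\<exists>xhat \<in> (\<Inter>i\<in>{1..m}. (+) (d i) ` F i). R_linear_convergence x xhat c \<and> dist xhat a < \<rho>)"
proof -
  have fin: "finite {1..m}" "{1..m} \<noteq> {}"
    using m by auto
  \<comment> \<open>\<open>\<eta> * M\<close> bounds the starting distance plus the geometric
    series, each \<open>x 0 - (d i + a)\<close> having norm at most \<open>2 * \<eta>\<close>.
    Keeping it at \<open>min (e / 2) \<rho>\<close> confines the iterates, leaves the other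
    \<open>e / 2\<close> for the shifts, and places the limit within \<open>\<rho>\<close> of
    \<open>a\<close>.\<close>
  define M where "M = 1 + real m * 2 / (1 - c)"
  define \<eta> where "\<eta> = min (e / 2) \<rho> / M"
  have M: "1 \<le> M"
    using c by (simp add: M_def)
  have \<eta>: "0 < \<eta>" "\<eta> * M = min (e / 2) \<rho>"
    using M assms(7,8) by (simp_all add: \<eta>_def)
  have "\<eta> * 1 \<le> \<eta> * M"
    using M \<eta>(1) by (intro mult_left_mono) auto
  then have \<eta>_le: "\<eta> \<le> e / 2"
    using \<eta>(2) by simp
  have "\<exists>xhat \<in> (\<Inter>i\<in>{1..m}. (+) (d i) ` F i). R_linear_convergence x xhat c \<and> dist xhat a < \<rho>"
    if d: "\<forall>i\<in>{1..m}. norm (d i) < \<eta>" and x0: "dist (x 0) a < \<eta>"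
      and x: "averaged_projections m (\<lambda>i. (+) (d i) ` F i) x" for d x
  proof -
    have "norm (x 0 - (d i + a)) \<le> 2 * \<eta>" if "i \<in> {1..m}" for i
      using bspec[OF d that] x0 norm_triangle_ineq4[of "x 0 - a" "d i"]
      by (simp add: dist_norm algebra_simps)
    then have "l2_norm {1..m} (\<lambda>i. x 0 - (d i + a)) \<le> real m * (2 * \<eta>)"
      using l2_norm_le_bound[of "{1..m}" "\<lambda>i. x 0 - (d i + a)" "2 * \<eta>"] by simp
    then have "l2_norm {1..m} (\<lambda>i. x 0 - (d i + a)) / (1 - c) \<le> real m * (2 * \<eta>) / (1 - c)"
      using c by (intro divide_right_mono) auto
    moreover have "\<eta> + real m * (2 * \<eta>) / (1 - c) = min (e / 2) \<rho>"
      unfolding \<eta>(2)[symmetric] M_def by (simp add: algebra_simps)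
    ultimately have b: "dist (x 0) a + l2_norm {1..m} (\<lambda>i. x 0 - (d i + a)) / (1 - c) < min (e / 2) \<rho>"
      using x0 by linarith
    have "\<exists>xhat \<in> (\<Inter>i\<in>{1..m}. (+) (d i) ` F i). R_linear_convergence x xhat c \<and>
        dist xhat a \<le> dist (x 0) a + l2_norm {1..m} (\<lambda>i. x 0 - (d i + a)) / (1 - c)"
    proof (rule averaged_projections_convergence[OF m _ _ c _ x, where e = "e / 2"])
      show "closed ((+) (d i) ` F i)" if "i \<in> {1..m}" for i
        using F(1)[OF that] by (rule closed_translation)
      show "d i + a \<in> (+) (d i) ` F i" if "i \<in> {1..m}" for i
        using F(2)[OF that] by blast
      show "l2_norm {1..m} (\<lambda>i. mean {1..m} z - z' i) \<le> c * l2_norm {1..m} (\<lambda>i. u - z i)"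
        if "\<And>i. i \<in> {1..m} \<Longrightarrow> z i \<in> metric_projection ((+) (d i) ` F i) u"
          "\<And>i. i \<in> {1..m} \<Longrightarrow> z' i \<in> metric_projection ((+) (d i) ` F i) (mean {1..m} z)"
          "dist u a < e / 2" for u z z'
      proof (rule translated_projection_contraction[OF fin dev that(1,2)])
        show "dist u a + norm (d i) < e" if "i \<in> {1..m}" for i
          using bspec[OF d that] \<open>dist u a < e / 2\<close> \<eta>_le by linarith
      qed
      show "dist (x 0) a + l2_norm {1..m} (\<lambda>i. x 0 - (d i + a)) / (1 - c) < e / 2"
        using b by linarith
    qed
    then show ?thesis
      using b by (meson le_less_trans min_less_iff_conj)
  qed
  then show ?thesis
    using \<eta>(1) by blast
qed

lemma super_regular_averaged_projections_convergence:
  fixes F :: "nat \<Rightarrow> 'a::euclidean_space set"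
  assumes m: "1 \<le> m" and F: "\<And>i. i \<in> {1..m} \<Longrightarrow> closed (F i)" "\<And>i. i \<in> {1..m} \<Longrightarrow> a \<in> F i"
    and sr: "\<And>i. i \<in> {1..m} \<Longrightarrow> super_regular (F i) a"
    and c: "0 < c'" "c' < c" "c < 1" and dev: "deviation_bound {1..m} F a e c'" and "0 < e"
  shows "\<exists>\<eta>>0. \<forall>x. dist (x 0) a < \<eta> \<and> averaged_projections m F x \<longrightarrow>
    (\<exists>xhat \<in> (\<Inter>i\<in>{1..m}. F i). R_linear_convergence x xhat (c\<^sup>2))"
proof -
  have fin: "finite {1..m}" "{1..m} \<noteq> {}"
    using m by auto
  \<comment> \<open>The super-regularity error \<open>2 * \<delta>\<close> fills the gap between
    \<open>c'\<close> and \<open>c\<close>, so one step contracts by \<open>c * c'\<close>, which is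
    at most \<open>c\<^sup>2\<close>.\<close>
  define \<delta> where "\<delta> = (c - c') / 2"
  have \<delta>: "0 < \<delta>" "c' + 2 * \<delta> = c"
    using c by (simp_all add: \<delta>_def field_simps)
  have c2: "0 < c\<^sup>2" "c\<^sup>2 < 1"
    using c by (simp_all add: power_less_one_iff)
  obtain e1 where e1: "0 < e1" "\<forall>i\<in>{1..m}. \<forall>u z y. dist u a < e1 \<longrightarrow> dist z a < e1 \<longrightarrow> z \<in> F i \<longrightarrow>
    y \<in> metric_projection (F i) u \<longrightarrow>
    inner (z - y) (u - y) \<le> \<delta> * norm (z - y) * norm (u - y)"
    using super_regular_uniform[where F = F, OF fin(1) sr \<delta>(1)] by blast
  define e2 where "e2 = min e e1"
  have e2: "0 < e2" and dev2: "deviation_bound {1..m} F a e2 c'"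
    using e1(1) assms(9) deviation_bound_mono[OF dev] by (simp_all add: e2_def)
  define M where "M = 1 + real m / (1 - c\<^sup>2)"
  define \<eta> where "\<eta> = e2 / 2 / M"
  have M: "1 \<le> M"
    using c2 by (simp add: M_def)
  have \<eta>: "0 < \<eta>" "\<eta> * M = e2 / 2"
    using M e2 by (simp_all add: \<eta>_def)
  have "\<exists>xhat \<in> (\<Inter>i\<in>{1..m}. F i). R_linear_convergence x xhat (c\<^sup>2)"
    if x0: "dist (x 0) a < \<eta>" and x: "averaged_projections m F x" for x
  proof -
    have "l2_norm {1..m} (\<lambda>i. x 0 - a) \<le> real (card {1..m}) * \<eta>"
      using x0 by (intro l2_norm_le_bound) (simp add: dist_norm)
    then have "l2_norm {1..m} (\<lambda>i. x 0 - a) / (1 - c\<^sup>2) \<le> real m * \<eta> / (1 - c\<^sup>2)"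
      using c2 by (intro divide_right_mono) auto
    moreover have "\<eta> + real m * \<eta> / (1 - c\<^sup>2) = e2 / 2"
      unfolding \<eta>(2)[symmetric] M_def by (simp add: algebra_simps)
    ultimately have b: "dist (x 0) a + l2_norm {1..m} (\<lambda>i. x 0 - a) / (1 - c\<^sup>2) < e2 / 2"
      using x0 by linarith
    have "\<exists>xhat \<in> (\<Inter>i\<in>{1..m}. F i). R_linear_convergence x xhat (c\<^sup>2) \<and>
        dist xhat a \<le> dist (x 0) a + l2_norm {1..m} (\<lambda>i. x 0 - a) / (1 - c\<^sup>2)"
    proof (rule averaged_projections_convergence[OF m F c2 _ x b])
      show "l2_norm {1..m} (\<lambda>i. mean {1..m} z - z' i) \<le> c\<^sup>2 * l2_norm {1..m} (\<lambda>i. u - z i)"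
        if "\<And>i. i \<in> {1..m} \<Longrightarrow> z i \<in> metric_projection (F i) u"
          "\<And>i. i \<in> {1..m} \<Longrightarrow> z' i \<in> metric_projection (F i) (mean {1..m} z)"
          "dist u a < e2 / 2" "dist (mean {1..m} z) a < e2 / 2" for u z z'
      proof -
        have "l2_norm {1..m} (\<lambda>i. mean {1..m} z - z' i)
            \<le> (c' + 2 * \<delta>) * c' * l2_norm {1..m} (\<lambda>i. u - z i)"
        proof (rule super_regular_contraction[OF fin F(2) _ _ dev2 _ that])
          show "inner (z - y) (u - y) \<le> \<delta> * norm (z - y) * norm (u - y)"
            if "i \<in> {1..m}" "dist u a < e2" "dist z a < e2" "z \<in> F i" "y \<in> metric_projection (F i) u"
            for i u z y
          proof -
            have "dist u a < e1" "dist z a < e1"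
              using that(2,3) by (simp_all add: e2_def)
            then show ?thesis
              using e1(2) that(1,4,5) by blast
          qed
        qed (use c \<delta> in auto)
        also have "\<dots> \<le> c\<^sup>2 * l2_norm {1..m} (\<lambda>i. u - z i)"
          unfolding \<delta>(2) power2_eq_square using c by (intro mult_right_mono mult_left_mono) auto
        finally show ?thesis .
      qed
    qed
    then show ?thesis
      by blast
  qed
  then show ?thesis
    using \<eta>(1) by blast
qed

theorem theorem7p3:
  fixes F :: "nat \<Rightarrow> 'a::euclidean_space set" and m :: nat and xbar :: 'a
  assumes "m \<ge> 1"
    and "\<And>i. i \<in> {1..m} \<Longrightarrow> closed (F i)"
    and "xbar \<in> (\<Inter>i\<in>{1..m}. F i)"
    and "strongly_regular_intersection m F xbar"
  shows "\<exists>cbar::real. 0 \<le> cbar \<and> cbar < 1 \<and>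
    cbar\<^sup>2 = (if xbar \<in> (\<Inter>i\<in>{1..m}. interior (F i)) then 0
              else 1 - 1 / (real m * (cond_modulus m F xbar)\<^sup>2)) \<and>
    (\<forall>c. cbar < c \<and> c < 1 \<longrightarrow>
      (\<exists>\<delta>>0. \<forall>x. dist (x 0) xbar < \<delta> \<and> averaged_projections m F x \<longrightarrow>
         (\<exists>xhat \<in> (\<Inter>i\<in>{1..m}. F i). R_linear_convergence x xhat c)) \<and>
      ((\<forall>i\<in>{1..m}. super_regular (F i) xbar) \<longrightarrow>
        (\<exists>\<delta>>0. \<forall>x. dist (x 0) xbar < \<delta> \<and> averaged_projections m F x \<longrightarrow>
           (\<exists>xhat \<in> (\<Inter>i\<in>{1..m}. F i). R_linear_convergence x xhat (c\<^sup>2)))) \<and>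
      (\<forall>U. open U \<and> xbar \<in> U \<longrightarrow>
        (\<exists>\<epsilon>>0. \<forall>d x. (\<forall>i\<in>{1..m}. norm (d i) < \<epsilon>) \<and> x 0 = xbar \<and>
             averaged_projections m (\<lambda>i. (+) (d i) ` F i) x \<longrightarrow>
           (\<exists>xhat \<in> U \<inter> (\<Inter>i\<in>{1..m}. (+) (d i) ` F i). R_linear_convergence x xhat c))))"
proof -
  define C where "C = (if xbar \<in> (\<Inter>i\<in>{1..m}. interior (F i)) then 0
              else 1 - 1 / (real m * (cond_modulus m F xbar)\<^sup>2))"
  define cbar where "cbar = sqrt C"
  have mem: "xbar \<in> F i" if "i \<in> {1..m}" for i
    using assms(3) that by blast
  \<comment> \<open>This makes the square root a legitimate \<open>cbar\<close> in
    \<open>[0, 1)\<close>; off the interior case it rests on the lower bound for the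
    modulus.\<close>
  have C: "0 \<le> C \<and> C < 1"
  proof (cases "xbar \<in> (\<Inter>i\<in>{1..m}. interior (F i))")
    case False
    define K where "K = real m * (cond_modulus m F xbar)\<^sup>2"
    have "1 \<le> K"
      unfolding K_def by (rule cond_modulus_lower_bound(1)[OF assms(1,4,2) mem False])
    moreover have "C = 1 - 1 / K"
      unfolding C_def K_def by (simp only: False if_False)
    ultimately show ?thesis
      by simp
  qed (simp only: C_def if_True, simp)
  have cbar: "0 \<le> cbar" "cbar < 1" "cbar\<^sup>2 = C"
    using C by (simp_all add: cbar_def)
  have bound: "\<exists>e>0. deviation_bound {1..m} F xbar e c" if "cbar < c" "c < 1" for c
  proof (rule deviation_bound_nearby[OF assms(1,4,2) mem])
    show "0 < c" "c < 1"
      using that cbar(1) by linarith+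
    have "cbar\<^sup>2 < c\<^sup>2"
      using that(1) cbar(1) by (intro power_strict_mono) auto
    then show "(if xbar \<in> (\<Inter>i\<in>{1..m}. interior (F i)) then 0
        else 1 - 1 / (real m * (cond_modulus m F xbar)\<^sup>2)) < c\<^sup>2"
      unfolding cbar(3) C_def .
  qed
  have perturbed: "\<exists>\<eta>>0. \<forall>d x. (\<forall>i\<in>{1..m}. norm (d i) < \<eta>) \<and> dist (x 0) xbar < \<eta> \<and>
      averaged_projections m (\<lambda>i. (+) (d i) ` F i) x \<longrightarrow>
    (\<exists>xhat \<in> (\<Inter>i\<in>{1..m}. (+) (d i) ` F i). R_linear_convergence x xhat c \<and> dist xhat xbar < \<rho>)"
    if c: "cbar < c" "c < 1" and "0 < \<rho>" for c \<rho>
  proof -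
    obtain e where e: "0 < e" "deviation_bound {1..m} F xbar e c"
      using bound[OF c] by blast
    have "0 < c"
      using c(1) cbar(1) by linarith
    from perturbed_averaged_projections_convergence[where F = F,
        OF assms(1,2) mem this c(2) e(2,1) \<open>0 < \<rho>\<close>]
    show ?thesis .
  qed
  have base: "\<exists>\<delta>>0. \<forall>x. dist (x 0) xbar < \<delta> \<and> averaged_projections m F x \<longrightarrow>
         (\<exists>xhat \<in> (\<Inter>i\<in>{1..m}. F i). R_linear_convergence x xhat c)"
    if c: "cbar < c" "c < 1" for c
  proof -
    obtain \<eta> where "\<eta> > 0" and \<eta>: "\<And>d x. (\<forall>i\<in>{1..m}. norm (d i) < \<eta>) \<and> dist (x 0) xbar < \<eta> \<and>
      averaged_projections m (\<lambda>i. (+) (d i) ` F i) x \<Longrightarrow>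
      (\<exists>xhat \<in> (\<Inter>i\<in>{1..m}. (+) (d i) ` F i). R_linear_convergence x xhat c \<and> dist xhat xbar < 1)"
      using perturbed[OF c zero_less_one] by blast
    have "\<exists>xhat \<in> (\<Inter>i\<in>{1..m}. F i). R_linear_convergence x xhat c"
      if "dist (x 0) xbar < \<eta>" "averaged_projections m F x" for x
      \<comment> \<open>Zero shifts leave the sets unchanged, so the unperturbed claim is an
        instance; the radius 1 for the limit was arbitrary.\<close>
      using \<eta>[of "\<lambda>_. 0" x] that \<open>\<eta> > 0\<close> by simp blast
    then show ?thesis
      using \<open>\<eta> > 0\<close> by blast
  qed
  have super: "\<exists>\<delta>>0. \<forall>x. dist (x 0) xbar < \<delta> \<and> averaged_projections m F x \<longrightarrow>
         (\<exists>xhat \<in> (\<Inter>i\<in>{1..m}. F i). R_linear_convergence x xhat (c\<^sup>2))"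
    if c: "cbar < c" "c < 1" and sr: "\<forall>i\<in>{1..m}. super_regular (F i) xbar" for c
  proof -
    \<comment> \<open>A rate strictly between \<open>cbar\<close> and \<open>c\<close> leaves room
      for the super-regularity error.\<close>
    define c' where "c' = (cbar + c) / 2"
    have c': "cbar < c'" "c' < c" "0 < c'" "c' < 1"
      using c cbar(1) by (simp_all add: c'_def)
    obtain e where "0 < e" "deviation_bound {1..m} F xbar e c'"
      using bound[OF c'(1,4)] by blast
    then show ?thesis
      using super_regular_averaged_projections_convergence[where F = F,
          OF assms(1,2) mem bspec[OF sr] c'(3,2) c(2)]
      by blast
  qed
  have translated: "\<exists>\<epsilon>>0. \<forall>d x. (\<forall>i\<in>{1..m}. norm (d i) < \<epsilon>) \<and> x 0 = xbar \<and>
             averaged_projections m (\<lambda>i. (+) (d i) ` F i) x \<longrightarrow>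
           (\<exists>xhat \<in> U \<inter> (\<Inter>i\<in>{1..m}. (+) (d i) ` F i). R_linear_convergence x xhat c)"
    if c: "cbar < c" "c < 1" and U: "open U" "xbar \<in> U" for c U
  proof -
    obtain \<rho> where \<rho>: "0 < \<rho>" "ball xbar \<rho> \<subseteq> U"
      using U by (rule openE)
    obtain \<eta> where "\<eta> > 0" and \<eta>: "\<And>d x. (\<forall>i\<in>{1..m}. norm (d i) < \<eta>) \<and> dist (x 0) xbar < \<eta> \<and>
      averaged_projections m (\<lambda>i. (+) (d i) ` F i) x \<Longrightarrow>
      (\<exists>xhat \<in> (\<Inter>i\<in>{1..m}. (+) (d i) ` F i). R_linear_convergence x xhat c \<and> dist xhat xbar < \<rho>)"
      using perturbed[OF c \<rho>(1)] by blast
    have "\<exists>xhat \<in> U \<inter> (\<Inter>i\<in>{1..m}. (+) (d i) ` F i). R_linear_convergence x xhat c"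
      if d: "\<forall>i\<in>{1..m}. norm (d i) < \<eta>" and x: "x 0 = xbar" "averaged_projections m (\<lambda>i. (+) (d i) ` F i) x"
      for d x
    proof -
      have "dist (x 0) xbar < \<eta>"
        using x(1) \<open>\<eta> > 0\<close> by simp
      then obtain xhat where xh: "xhat \<in> (\<Inter>i\<in>{1..m}. (+) (d i) ` F i)" "R_linear_convergence x xhat c"
          "dist xhat xbar < \<rho>"
        using \<eta>[of d x] d x(2) by blast
      have "xhat \<in> ball xbar \<rho>"
        using xh(3) by (simp add: dist_commute)
      then have "xhat \<in> U"
        using \<rho>(2) by blast
      then show ?thesis
        using xh by blast
    qed
    then show ?thesis
      using \<open>\<eta> > 0\<close> by blast
  qed
  show ?thesis
    by (rule exI[of _ cbar], intro conjI allI impI cbar[unfolded C_def];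
        elim conjE, rule base super translated; assumption)
qed

unused_thms

end
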